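(* Let $(W,S)$ be a finite Coxeter system and $\theta:W\to W$ a group automorphism with $\theta^2=\mathrm{id}$ and $\theta(S)=S$. The $h$-polynomial of $\Delta_\theta$ equals \[ \mathrm{des}_\theta(x)=\sum_{w\in\mathfrak{I}(\theta)}x^{|D_R(w)|}. \]
   Context: $\ell$ is the length function, $D_R(w)=\{s\in S\mid \ell(ws)<\ell(w)\}$, and $\mathfrak{I}(\theta)=\{w\in W\mid \theta(w)=w^{-1}\}$. For $s\in S$, $\underline{s}$ acts on the right on $W$ by $w\underline{s}=ws$ if $\theta(s)ws=w$, and $w\underline{s}=\theta(s)ws$ otherwise; this preserves $\mathfrak{I}(\theta)$. Let $G_\theta$ be the edge-labelled graph on vertex set $\mathfrak{I}(\theta)$ with an edge labelled $s$ between $v$ and $w$ whenever $v\underline{s}=w$. For $J\subseteq S$ and $w\in\mathfrak{I}(\theta)$, $wC_J$ is the connected component containing $w$ of the subgraph of $G_\theta$ keeping only edges with labels in $J$ (as a labelled graph). The set $P_\theta=\{wC_J\}$ ordered by reverse inclusion of labelled subgraphs is the face poset of a pure Boolean cell complex $\Delta_\theta$ of dimension $d=|S|-1$, in which $wC_J$ is a cell of dimension $|S|-|J|-1$ (and $G_\theta=wC_S$ is the empty cell of dimension $-1$). If $f_i$ is the number of $i$-dimensional cells ($f_{-1}=1$), the $f$-polynomial is $f(x)=\sum_{i\geq0}f_{i-1}x^i$ and the $h$-polynomial is $h(x)=(1-x)^{d+1}f\!\left(\frac{x}{1-x}\right)$. *)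

theory Defs
  imports Complex_Main "HOL-Algebra.Generated_Groups" "HOL-Computational_Algebra.Polynomial"
begin

section \<open>Coxeter systems\<close>

text \<open>The entry \<open>0\<close> of a Coxeter matrix stands for \<open>\<infinity>\<close>, i.e. for the absence of a relation.\<close>

definition coxeter_matrix :: "'a set \<Rightarrow> ('a \<Rightarrow> 'a \<Rightarrow> nat) \<Rightarrow> bool" where
  "coxeter_matrix S m \<longleftrightarrow>
     (\<forall>s\<in>S. \<forall>t\<in>S. m s t = m t s \<and> (m s t = 1 \<longleftrightarrow> s = t))"

definition coxeter_step :: "'a set \<Rightarrow> ('a \<Rightarrow> 'a \<Rightarrow> nat) \<Rightarrow> 'a list \<Rightarrow> 'a list \<Rightarrow> bool" where
  "coxeter_step S m xs ys \<longleftrightarrow>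
     (\<exists>u\<in>lists S. \<exists>v\<in>lists S. \<exists>s\<in>S. \<exists>t\<in>S. m s t \<noteq> 0 \<and>
        xs = u @ concat (replicate (m s t) [s, t]) @ v \<and> ys = u @ v)"

definition word_prod :: "('a, 'b) monoid_scheme \<Rightarrow> 'a list \<Rightarrow> 'a" where
  "word_prod G xs = foldr (\<lambda>x y. x \<otimes>\<^bsub>G\<^esub> y) xs \<one>\<^bsub>G\<^esub>"

text \<open>The group presentation \<open>\<langle>S | (st)\<^bsup>m s t\<^esup> = 1\<rangle>\<close>. Words in the generators suffice (formal
  inverses are not needed), since \<open>m s s = 1\<close> gives the relation \<open>ss = 1\<close>.\<close>

definition coxeter_system :: "('a, 'b) monoid_scheme \<Rightarrow> 'a set \<Rightarrow> bool" where
  "coxeter_system G S \<longleftrightarrow>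
     group G \<and> S \<subseteq> carrier G \<and> generate G S = carrier G \<and>
     (\<exists>m. coxeter_matrix S m \<and>
        (\<forall>u\<in>lists S. \<forall>v\<in>lists S.
           word_prod G u = word_prod G v \<longleftrightarrow> equivclp (coxeter_step S m) u v))"

definition cox_length :: "('a, 'b) monoid_scheme \<Rightarrow> 'a set \<Rightarrow> 'a \<Rightarrow> nat" where
  "cox_length G S w = (LEAST n. \<exists>u\<in>lists S. length u = n \<and> word_prod G u = w)"

definition right_descents :: "('a, 'b) monoid_scheme \<Rightarrow> 'a set \<Rightarrow> 'a \<Rightarrow> 'a set" where
  "right_descents G S w = {s \<in> S. cox_length G S (w \<otimes>\<^bsub>G\<^esub> s) < cox_length G S w}"


section \<open>Twisted involutions\<close>

definition twisted_involutions :: "('a, 'b) monoid_scheme \<Rightarrow> ('a \<Rightarrow> 'a) \<Rightarrow> 'a set" where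
  "twisted_involutions G \<theta> = {w \<in> carrier G. \<theta> w = inv\<^bsub>G\<^esub> w}"

definition underline_act :: "('a, 'b) monoid_scheme \<Rightarrow> ('a \<Rightarrow> 'a) \<Rightarrow> 'a \<Rightarrow> 'a \<Rightarrow> 'a" where
  "underline_act G \<theta> w s =
     (if \<theta> s \<otimes>\<^bsub>G\<^esub> w \<otimes>\<^bsub>G\<^esub> s = w then w \<otimes>\<^bsub>G\<^esub> s else \<theta> s \<otimes>\<^bsub>G\<^esub> w \<otimes>\<^bsub>G\<^esub> s)"

definition des_poly :: "('a, 'b) monoid_scheme \<Rightarrow> 'a set \<Rightarrow> ('a \<Rightarrow> 'a) \<Rightarrow> real poly" where
  "des_poly G S \<theta> = (\<Sum>w\<in>twisted_involutions G \<theta>. monom 1 (card (right_descents G S w)))"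


section \<open>Edge-labelled graphs\<close>

text \<open>A graph is a set of vertices together with a set of undirected labelled edges \<open>({v, w}, s)\<close>.\<close>

type_synonym ('v, 'l) lgraph = "'v set \<times> ('v set \<times> 'l) set"

definition lsubgraph :: "('v, 'l) lgraph \<Rightarrow> ('v, 'l) lgraph \<Rightarrow> bool" where
  "lsubgraph A B \<longleftrightarrow> fst A \<subseteq> fst B \<and> snd A \<subseteq> snd B"

definition keep_labels :: "'l set \<Rightarrow> ('v, 'l) lgraph \<Rightarrow> ('v, 'l) lgraph" where
  "keep_labels J A = (fst A, {(e, s) \<in> snd A. s \<in> J})"

definition lcomponent_verts :: "('v, 'l) lgraph \<Rightarrow> 'v \<Rightarrow> 'v set" where
  "lcomponent_verts A w = {v. (w, v) \<in> {(x, y). \<exists>s. ({x, y}, s) \<in> snd A}\<^sup>*}"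

definition lcomponent :: "('v, 'l) lgraph \<Rightarrow> 'v \<Rightarrow> ('v, 'l) lgraph" where
  "lcomponent A w = (lcomponent_verts A w, {(e, s) \<in> snd A. e \<subseteq> lcomponent_verts A w})"

definition twisted_graph ::
    "('a, 'b) monoid_scheme \<Rightarrow> 'a set \<Rightarrow> ('a \<Rightarrow> 'a) \<Rightarrow> ('a, 'a) lgraph" where
  "twisted_graph G S \<theta> =
     (twisted_involutions G \<theta>,
      {({v, w}, s) | v w s. v \<in> twisted_involutions G \<theta> \<and> w \<in> twisted_involutions G \<theta> \<and>
         s \<in> S \<and> underline_act G \<theta> v s = w})"

definition coset_component ::
    "('a, 'b) monoid_scheme \<Rightarrow> 'a set \<Rightarrow> ('a \<Rightarrow> 'a) \<Rightarrow> 'a \<Rightarrow> 'a set \<Rightarrow> ('a, 'a) lgraph" where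
  "coset_component G S \<theta> w J = lcomponent (keep_labels J (twisted_graph G S \<theta>)) w"


section \<open>Boolean cell complexes\<close>

text \<open>A Boolean cell complex is represented by its face poset: the set \<open>P\<close> of its cells,
  including the empty cell, ordered by \<open>leq\<close>. An \<open>i\<close>-dimensional cell is one whose lower
  interval is isomorphic to the lattice of subsets of an \<open>(i + 1)\<close>-element set; in particular the
  empty cell has dimension \<open>-1\<close>.\<close>

definition boolean_below :: "'c set \<Rightarrow> ('c \<Rightarrow> 'c \<Rightarrow> bool) \<Rightarrow> 'c \<Rightarrow> nat \<Rightarrow> bool" where
  "boolean_below P leq x n \<longleftrightarrow>
     (\<exists>f. bij_betw f (Pow {..<n}) {y \<in> P. leq y x} \<and>
        (\<forall>A\<in>Pow {..<n}. \<forall>B\<in>Pow {..<n}. leq (f A) (f B) \<longleftrightarrow> A \<subseteq> B))"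

definition cell_dim :: "'c set \<Rightarrow> ('c \<Rightarrow> 'c \<Rightarrow> bool) \<Rightarrow> 'c \<Rightarrow> int" where
  "cell_dim P leq x = int (THE n. boolean_below P leq x n) - 1"

definition complex_dim :: "'c set \<Rightarrow> ('c \<Rightarrow> 'c \<Rightarrow> bool) \<Rightarrow> int" where
  "complex_dim P leq = Max (cell_dim P leq ` P)"

definition face_number :: "'c set \<Rightarrow> ('c \<Rightarrow> 'c \<Rightarrow> bool) \<Rightarrow> int \<Rightarrow> nat" where
  "face_number P leq i = card {x \<in> P. cell_dim P leq x = i}"

definition f_poly :: "'c set \<Rightarrow> ('c \<Rightarrow> 'c \<Rightarrow> bool) \<Rightarrow> real poly" where
  "f_poly P leq =
     (\<Sum>i = 0..nat (complex_dim P leq + 1). monom (of_nat (face_number P leq (int i - 1))) i)"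

text \<open>The polynomial determined by the identity \<open>h(x) = (1 - x)\<^bsup>d + 1\<^esup> f(x / (1 - x))\<close> of rational
  functions, read pointwise away from the pole \<open>x = 1\<close>.\<close>

definition h_poly :: "'c set \<Rightarrow> ('c \<Rightarrow> 'c \<Rightarrow> bool) \<Rightarrow> real poly" where
  "h_poly P leq =
     (THE h. \<forall>x. x \<noteq> 1 \<longrightarrow>
        poly h x = (1 - x) ^ nat (complex_dim P leq + 1) * poly (f_poly P leq) (x / (1 - x)))"


section \<open>The complex of twisted involutions\<close>

definition twisted_cells ::
    "('a, 'b) monoid_scheme \<Rightarrow> 'a set \<Rightarrow> ('a \<Rightarrow> 'a) \<Rightarrow> ('a, 'a) lgraph set" where
  "twisted_cells G S \<theta> =
     {coset_component G S \<theta> w J | w J. w \<in> twisted_involutions G \<theta> \<and> J \<subseteq> S}"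

definition face_of :: "('v, 'l) lgraph \<Rightarrow> ('v, 'l) lgraph \<Rightarrow> bool" where
  "face_of A B \<longleftrightarrow> lsubgraph B A"


subsection \<open>The complex is Boolean\<close>

lemma coxeter_generator_square:
  assumes "coxeter_system G S" "s \<in> S"
  shows "s \<otimes>\<^bsub>G\<^esub> s = \<one>\<^bsub>G\<^esub>"
proof -
  interpret group G using assms by (simp add: coxeter_system_def)
  from assms obtain m where m: "coxeter_matrix S m"
    "\<And>u v. u \<in> lists S \<Longrightarrow> v \<in> lists S \<Longrightarrow>
       word_prod G u = word_prod G v \<longleftrightarrow> equivclp (coxeter_step S m) u v"
    by (auto simp: coxeter_system_def)
  have "m s s = 1" using m(1) assms(2) by (simp add: coxeter_matrix_def)
  hence "coxeter_step S m [s, s] []"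
    unfolding coxeter_step_def using assms(2) by (intro bexI[of _ "[]"] bexI[of _ s]) auto
  hence "word_prod G [s, s] = word_prod G []"
    using m(2)[of "[s,s]" "[]"] assms(2) by (auto intro: r_into_equivclp)
  moreover have "s \<in> carrier G" using assms by (auto simp: coxeter_system_def)
  ultimately show ?thesis by (simp add: word_prod_def)
qed

lemma underline_act_closed:
  assumes cox: "coxeter_system G S" and th: "\<theta> \<in> iso G G"
    and inv: "\<And>w. w \<in> carrier G \<Longrightarrow> \<theta> (\<theta> w) = w" and thS: "\<theta> ` S = S"
    and w: "w \<in> twisted_involutions G \<theta>" and s: "s \<in> S"
  shows "underline_act G \<theta> w s \<in> twisted_involutions G \<theta>"
proof -
  interpret group G using cox by (simp add: coxeter_system_def)
  define t where "t = \<theta> s"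
  have tS: "t \<in> S" using thS s by (auto simp: t_def)
  have c: "s \<in> carrier G" "t \<in> carrier G" "w \<in> carrier G"
    using s tS cox w by (auto simp: coxeter_system_def twisted_involutions_def)
  have hm: "\<theta> (x \<otimes>\<^bsub>G\<^esub> y) = \<theta> x \<otimes>\<^bsub>G\<^esub> \<theta> y" if "x \<in> carrier G" "y \<in> carrier G" for x y
    using th that by (auto simp: iso_def hom_def)
  have tt: "\<theta> t = s" using inv c by (simp add: t_def)
  have tw: "\<theta> w = inv\<^bsub>G\<^esub> w" using w by (simp add: twisted_involutions_def)
  have sel: "inv\<^bsub>G\<^esub> s = s" "inv\<^bsub>G\<^esub> t = t"
    using coxeter_generator_square[OF cox s] coxeter_generator_square[OF cox tS] c inv_equality by auto
  show ?thesis
  proof (cases "t \<otimes>\<^bsub>G\<^esub> w \<otimes>\<^bsub>G\<^esub> s = w")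
    case True
    have "inv\<^bsub>G\<^esub> w = inv\<^bsub>G\<^esub> (t \<otimes>\<^bsub>G\<^esub> w \<otimes>\<^bsub>G\<^esub> s)" using True by simp
    also have "\<dots> = s \<otimes>\<^bsub>G\<^esub> inv\<^bsub>G\<^esub> w \<otimes>\<^bsub>G\<^esub> t" using c sel by (simp add: inv_mult_group m_assoc)
    finally have e: "inv\<^bsub>G\<^esub> w \<otimes>\<^bsub>G\<^esub> t = s \<otimes>\<^bsub>G\<^esub> inv\<^bsub>G\<^esub> w \<otimes>\<^bsub>G\<^esub> t \<otimes>\<^bsub>G\<^esub> t" by simp
    also have "\<dots> = s \<otimes>\<^bsub>G\<^esub> inv\<^bsub>G\<^esub> w"
      using c coxeter_generator_square[OF cox tS] by (simp add: m_assoc)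
    finally show ?thesis using True c sel tw hm
      by (simp add: underline_act_def twisted_involutions_def t_def[symmetric] inv_mult_group)
  next
    case False
    thus ?thesis using c sel tw tt hm
      by (simp add: underline_act_def twisted_involutions_def t_def[symmetric] inv_mult_group m_assoc)
  qed
qed

lemma mem_lcomponent_verts_sym:
  assumes "v \<in> lcomponent_verts A w"
  shows "lcomponent A v = lcomponent A w"
proof -
  define R where "R = {(x, y). \<exists>s. ({x, y}, s) \<in> snd A}"
  have "sym R" by (auto simp: R_def sym_def insert_commute)
  hence "sym (R\<^sup>*)" by (rule sym_rtrancl)
  moreover have "(w, v) \<in> R\<^sup>*" using assms by (simp add: lcomponent_verts_def R_def)
  ultimately have "(w, x) \<in> R\<^sup>* \<longleftrightarrow> (v, x) \<in> R\<^sup>*" for x by (meson rtrancl_trans symD)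
  hence "lcomponent_verts A v = lcomponent_verts A w"
    by (simp add: lcomponent_verts_def R_def[symmetric])
  thus ?thesis by (simp add: lcomponent_def)
qed

lemma lcomponent_keep_labels_mono:
  assumes "J \<subseteq> K"
  shows "lsubgraph (lcomponent (keep_labels J A) w) (lcomponent (keep_labels K A) w)"
proof -
  have "lcomponent_verts (keep_labels J A) w \<subseteq> lcomponent_verts (keep_labels K A) w"
    unfolding lcomponent_verts_def
    by (intro Collect_mono impI, erule rtrancl_mono[THEN subsetD, rotated])
       (use assms in \<open>auto simp: keep_labels_def\<close>)
  thus ?thesis using assms by (auto simp: lsubgraph_def lcomponent_def keep_labels_def)
qed

context
  fixes G :: "('a, 'b) monoid_scheme" and S :: "'a set" and \<theta> :: "'a \<Rightarrow> 'a"
  assumes cox: "coxeter_system G S" and th: "\<theta> \<in> iso G G"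
    and inv: "\<And>w. w \<in> carrier G \<Longrightarrow> \<theta> (\<theta> w) = w" and thS: "\<theta> ` S = S"
begin

lemma coset_component_labels:
  assumes w: "w \<in> twisted_involutions G \<theta>" and J: "J \<subseteq> S"
  shows "snd ` snd (coset_component G S \<theta> w J) = J"
proof
  show "snd ` snd (coset_component G S \<theta> w J) \<subseteq> J"
    by (auto simp: coset_component_def lcomponent_def keep_labels_def)
  show "J \<subseteq> snd ` snd (coset_component G S \<theta> w J)"
  proof
    fix s assume s: "s \<in> J"
    define v where "v = underline_act G \<theta> w s"
    have "v \<in> twisted_involutions G \<theta>"
      unfolding v_def using underline_act_closed[OF cox th inv thS w] s J by auto
    hence e: "({w, v}, s) \<in> snd (keep_labels J (twisted_graph G S \<theta>))"
      using w s J by (auto simp: keep_labels_def twisted_graph_def v_def)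
    hence "v \<in> lcomponent_verts (keep_labels J (twisted_graph G S \<theta>)) w"
      by (auto simp: lcomponent_verts_def)
    moreover have "w \<in> lcomponent_verts (keep_labels J (twisted_graph G S \<theta>)) w"
      by (auto simp: lcomponent_verts_def)
    ultimately have "({w, v}, s) \<in> snd (coset_component G S \<theta> w J)"
      using e by (auto simp: coset_component_def lcomponent_def)
    thus "s \<in> snd ` snd (coset_component G S \<theta> w J)" by force
  qed
qed

lemma face_of_coset_component:
  assumes w: "w \<in> twisted_involutions G \<theta>" and J: "J \<subseteq> S" and K: "K \<subseteq> S"
  shows "face_of (coset_component G S \<theta> w K) (coset_component G S \<theta> w J) \<longleftrightarrow> J \<subseteq> K"
proof
  assume "face_of (coset_component G S \<theta> w K) (coset_component G S \<theta> w J)"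
  hence "snd ` snd (coset_component G S \<theta> w J) \<subseteq> snd ` snd (coset_component G S \<theta> w K)"
    by (auto simp: face_of_def lsubgraph_def)
  thus "J \<subseteq> K" using coset_component_labels w J K by simp
qed (simp add: face_of_def coset_component_def lcomponent_keep_labels_mono)

lemma faces_coset_component:
  assumes w: "w \<in> twisted_involutions G \<theta>" and J: "J \<subseteq> S"
  shows "{C \<in> twisted_cells G S \<theta>. face_of C (coset_component G S \<theta> w J)} =
         coset_component G S \<theta> w ` {K. J \<subseteq> K \<and> K \<subseteq> S}"  (is "?L = ?R")
proof
  show "?R \<subseteq> ?L" using w J by (auto simp: twisted_cells_def face_of_coset_component)
  show "?L \<subseteq> ?R"
  proof
    fix C assume "C \<in> ?L"
    then obtain v K where C: "C = coset_component G S \<theta> v K" "v \<in> twisted_involutions G \<theta>"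
      "K \<subseteq> S" and f: "face_of C (coset_component G S \<theta> w J)" by (auto simp: twisted_cells_def)
    have "w \<in> fst (coset_component G S \<theta> w J)"
      by (simp add: coset_component_def lcomponent_def lcomponent_verts_def)
    hence "w \<in> fst C" using f by (auto simp: face_of_def lsubgraph_def)
    hence "C = coset_component G S \<theta> w K"
      unfolding C coset_component_def
      by (subst mem_lcomponent_verts_sym[of w _ v]) (auto simp: lcomponent_def)
    thus "C \<in> ?R" using f face_of_coset_component[OF w J C(3)] C(3) by auto
  qed
qed

text \<open>Every cell is Boolean, and \<open>wC\<^sub>J\<close> has dimension \<open>|S| - |J| - 1\<close>.\<close>

lemma cell_dim_coset_component:
  assumes fin: "finite S" and w: "w \<in> twisted_involutions G \<theta>" and J: "J \<subseteq> S"
  shows "boolean_below (twisted_cells G S \<theta>) face_of (coset_component G S \<theta> w J) (card S - card J)"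
    and "cell_dim (twisted_cells G S \<theta>) face_of (coset_component G S \<theta> w J) =
         int (card S) - int (card J) - 1"
proof -
  let ?c = "coset_component G S \<theta> w" and ?P = "twisted_cells G S \<theta>"
  have n: "card (S - J) = card S - card J" using J fin by (simp add: card_Diff_subset finite_subset)
  obtain g where g: "bij_betw g {..<card (S - J)} (S - J)"
    using ex_bij_betw_nat_finite[of "S - J"] fin by (auto simp: atLeast0LessThan)
  define f where "f = (\<lambda>A. ?c (S - g ` A))"
  have gim: "g ` A \<subseteq> S - J" if "A \<subseteq> {..<card (S - J)}" for A
    using that g by (auto simp: bij_betw_def)
  have gsub: "g ` A \<subseteq> g ` B \<longleftrightarrow> A \<subseteq> B" if "A \<subseteq> {..<card (S - J)}" "B \<subseteq> {..<card (S - J)}" for A B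
  proof
    assume im: "g ` A \<subseteq> g ` B"
    show "A \<subseteq> B"
    proof
      fix x assume x: "x \<in> A"
      hence "g x \<in> g ` B" using im by blast
      moreover have "inj_on g {..<card (S - J)}" using g by (simp add: bij_betw_def)
      ultimately show "x \<in> B" using inj_on_image_mem_iff[of g _ x B] x that by (meson subsetD)
    qed
  qed (rule image_mono)
  have le: "face_of (f A) (f B) \<longleftrightarrow> A \<subseteq> B"
    if "A \<subseteq> {..<card (S - J)}" "B \<subseteq> {..<card (S - J)}" for A B
  proof -
    have "face_of (f A) (f B) \<longleftrightarrow> S - g ` B \<subseteq> S - g ` A"
      unfolding f_def by (rule face_of_coset_component[OF w]) auto
    also have "\<dots> \<longleftrightarrow> g ` A \<subseteq> g ` B" using gim[OF that(1)] gim[OF that(2)] by blast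
    finally show ?thesis using gsub[OF that] by simp
  qed
  have inj: "inj_on f (Pow {..<card (S - J)})"
  proof (rule inj_onI)
    fix A B assume AB: "A \<in> Pow {..<card (S - J)}" "B \<in> Pow {..<card (S - J)}" "f A = f B"
    have "face_of (f A) (f B)" "face_of (f B) (f A)"
      using AB(3) by (simp_all add: face_of_def lsubgraph_def)
    hence "A \<subseteq> B" "B \<subseteq> A" using AB(1,2) le by simp_all
    thus "A = B" by (rule equalityI)
  qed
  have img: "f ` Pow {..<card (S - J)} = {C \<in> ?P. face_of C (?c J)}"
    unfolding faces_coset_component[OF w J]
  proof (intro equalityI subsetI)
    fix C assume "C \<in> f ` Pow {..<card (S - J)}"
    then obtain A where A: "A \<subseteq> {..<card (S - J)}" "C = ?c (S - g ` A)" by (auto simp: f_def)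
    have "J \<subseteq> S - g ` A" using gim[OF A(1)] J by auto
    thus "C \<in> ?c ` {K. J \<subseteq> K \<and> K \<subseteq> S}" unfolding A(2) by (intro imageI) simp
  next
    fix C assume "C \<in> ?c ` {K. J \<subseteq> K \<and> K \<subseteq> S}"
    then obtain K where K: "C = ?c K" "J \<subseteq> K" "K \<subseteq> S" by blast
    have "S - K \<subseteq> g ` {..<card (S - J)}" using K g by (auto simp: bij_betw_def)
    then obtain A where A: "A \<subseteq> {..<card (S - J)}" "S - K = g ` A" by (meson subset_imageE)
    have "K = S - g ` A" using A K by auto
    thus "C \<in> f ` Pow {..<card (S - J)}" using A K by (auto simp: f_def)
  qed
  show b: "boolean_below ?P face_of (?c J) (card S - card J)"
    unfolding boolean_below_def n[symmetric]
  proof (intro exI[of _ f] conjI ballI)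
    show "bij_betw f (Pow {..<card (S - J)}) {C \<in> ?P. face_of C (?c J)}"
      using inj img by (rule bij_betw_imageI)
  qed (use le in simp)
  have u: "k = l" if "boolean_below ?P face_of (?c J) k" "boolean_below ?P face_of (?c J) l" for k l
  proof -
    have c: "card {C \<in> ?P. face_of C (?c J)} = 2 ^ k"
      if bb: "boolean_below ?P face_of (?c J) k" for k
    proof -
      obtain p where "bij_betw p (Pow {..<k}) {C \<in> ?P. face_of C (?c J)}"
        using bb unfolding boolean_below_def by (elim exE conjE)
      hence "card (Pow {..<k}) = card {C \<in> ?P. face_of C (?c J)}" by (rule bij_betw_same_card)
      thus ?thesis by (simp add: card_Pow)
    qed
    have "(2::nat) ^ k = 2 ^ l" using c[OF that(1)] c[OF that(2)] by (rule trans[OF sym])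
    thus ?thesis by simp
  qed
  have "(THE k. boolean_below ?P face_of (?c J) k) = card S - card J"
    using b u by (intro the_equality)
  moreover have "card J \<le> card S" using J fin by (simp add: card_mono)
  ultimately show "cell_dim ?P face_of (?c J) = int (card S) - int (card J) - 1"
    by (simp add: cell_dim_def of_nat_diff)
qed

lemma complex_dim_twisted_cells:
  assumes fin: "finite S"
  shows "complex_dim (twisted_cells G S \<theta>) face_of = int (card S) - 1"
proof -
  interpret group G using cox by (simp add: coxeter_system_def)
  have "\<theta> \<one>\<^bsub>G\<^esub> = \<one>\<^bsub>G\<^esub>" using th by (meson hom_one is_group iso_imp_homomorphism)
  hence one: "\<one>\<^bsub>G\<^esub> \<in> twisted_involutions G \<theta>" by (simp add: twisted_involutions_def)
  have sub: "cell_dim (twisted_cells G S \<theta>) face_of ` twisted_cells G S \<theta> \<subseteq>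
      {-1..int (card S) - 1}"
  proof
    fix i assume "i \<in> cell_dim (twisted_cells G S \<theta>) face_of ` twisted_cells G S \<theta>"
    then obtain w J where "w \<in> twisted_involutions G \<theta>" "J \<subseteq> S"
      "i = cell_dim (twisted_cells G S \<theta>) face_of (coset_component G S \<theta> w J)"
      unfolding twisted_cells_def by blast
    thus "i \<in> {-1..int (card S) - 1}"
      using cell_dim_coset_component(2)[OF fin] card_mono[OF fin, of J] by simp
  qed
  have "int (card S) - 1 = cell_dim (twisted_cells G S \<theta>) face_of (coset_component G S \<theta> \<one>\<^bsub>G\<^esub> {})"
    using cell_dim_coset_component(2)[OF fin one, of "{}"] by simp
  moreover have "coset_component G S \<theta> \<one>\<^bsub>G\<^esub> {} \<in> twisted_cells G S \<theta>"
    using one by (auto simp: twisted_cells_def)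
  ultimately have "int (card S) - 1 \<in> cell_dim (twisted_cells G S \<theta>) face_of ` twisted_cells G S \<theta>"
    by blast
  thus ?thesis unfolding complex_dim_def using sub
    by (intro Max_eqI) (auto intro: finite_subset[OF sub])
qed

end

end

theory Submission
  imports Defs "HOL-Library.Sublist"
begin

text \<open>The elements \<open>w\<close> of a component \<open>wC\<^sub>J\<close> lie in a single double coset
  of the parabolic subgroups generated by \<open>\<theta>(J)\<close> and \<open>J\<close>. If
  \<open>D\<^sub>R(w)\<close> misses \<open>J\<close>, then \<open>w\<close> is a twisted involution without left
  descents in \<open>\<theta>(J)\<close> or right descents in \<open>J\<close>, hence the minimal element of that
  double coset; and a right descent in \<open>J\<close> can always be used to shorten \<open>w\<close>
  within its component. So the components for \<open>J\<close> correspond to the \<open>w\<close> with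
  \<open>D\<^sub>R(w) \<inter> J = {}\<close>, which gives
  \<open>f(y) = (\<Sum>w. y\<^bsup>|D(w)|\<^esup> (1 + y)\<^bsup>|S| - |D(w)|\<^esup>)\<close>, and
  substituting \<open>y = x / (1 - x)\<close> collapses each summand to \<open>x\<^bsup>|D(w)|\<^esup>\<close>.
  Everything about lengths rests on the deletion property. It holds because the parity with which
  a reflection occurs in the reflection sequence of a word is invariant under the Coxeter relations,
  so a word with distinct reflections is reduced.\<close>

section \<open>The deletion property\<close>

lemma count_list_distinct: "distinct xs \<Longrightarrow> x \<in> set xs \<Longrightarrow> count_list xs x = 1"
  by (induction xs) auto

lemma subseq_in_lists: "subseq v u \<Longrightarrow> u \<in> lists A \<Longrightarrow> v \<in> lists A"
  by (auto simp: in_lists_conv_set elim!: list_emb_set)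

lemma rev_in_lists [simp]: "rev u \<in> lists A \<longleftrightarrow> u \<in> lists A"
  by (simp add: in_lists_conv_set)

section \<open>Words in the generators, their products and the length function\<close>

locale coxeter_group =
  fixes G :: "('a, 'b) monoid_scheme" (structure) and S :: "'a set"
  assumes cox: "coxeter_system G S"
begin

sublocale group G
  using cox by (simp add: coxeter_system_def)

declare in_listsD [rule del] in_listsI [rule del]

abbreviation wprod :: "'a list \<Rightarrow> 'a" where "wprod \<equiv> word_prod G"
abbreviation len :: "'a \<Rightarrow> nat" where "len \<equiv> cox_length G S"

lemma generator_closed [simp]: "s \<in> S \<Longrightarrow> s \<in> carrier G"
  using cox by (auto simp: coxeter_system_def)

lemma generator_square [simp]: "s \<in> S \<Longrightarrow> s \<otimes> s = \<one>"
  using cox by (rule coxeter_generator_square)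

lemma generator_inv [simp]: "s \<in> S \<Longrightarrow> inv s = s"
  by (simp add: inv_equality)

lemma generator_cancel [simp]: "s \<in> S \<Longrightarrow> x \<in> carrier G \<Longrightarrow> s \<otimes> (s \<otimes> x) = x"
  by (simp flip: m_assoc)

lemma wprod_Nil [simp]: "wprod [] = \<one>"
  by (simp add: word_prod_def)

lemma wprod_Cons [simp]: "wprod (x # u) = x \<otimes> wprod u"
  by (simp add: word_prod_def)

lemma wprod_closed [simp]: "u \<in> lists S \<Longrightarrow> wprod u \<in> carrier G"
  by (induction u) auto

lemma wprod_append [simp]:
  "u \<in> lists S \<Longrightarrow> v \<in> lists S \<Longrightarrow> wprod (u @ v) = wprod u \<otimes> wprod v"
  by (induction u) (auto simp: m_assoc)

lemma inv_wprod: "u \<in> lists S \<Longrightarrow> inv (wprod u) = wprod (rev u)"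
  by (induction u) (auto simp: inv_mult_group)

text \<open>\<open>generate\<close> also admits inverses; a generator is its own inverse, so the
  one-letter word \<open>[h]\<close> serves for \<open>h\<close> and for
  \<open>inv h\<close>.\<close>

lemma wprod_surj:
  assumes "w \<in> carrier G"
  shows "\<exists>u\<in>lists S. wprod u = w"
proof -
  have "w \<in> generate G S" using cox assms by (simp add: coxeter_system_def)
  thus ?thesis
  proof (induction rule: generate.induct)
    case one
    show ?case by (intro bexI[of _ "[]"]) auto
  next
    case (incl h)
    thus ?case by (intro bexI[of _ "[h]"]) auto
  next
    case (inv h)
    thus ?case by (intro bexI[of _ "[h]"]) auto
  next
    case (eng h1 h2)
    thus ?case by (metis append_in_lists_conv wprod_append)
  qed
qed

lemma reduced_word:
  assumes "w \<in> carrier G"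
  obtains u where "u \<in> lists S" "length u = len w" "wprod u = w"
proof -
  have "\<exists>n. \<exists>u\<in>lists S. length u = n \<and> wprod u = w" using wprod_surj[OF assms] by blast
  hence "\<exists>u\<in>lists S. length u = len w \<and> wprod u = w"
    unfolding cox_length_def by (rule LeastI_ex)
  thus ?thesis using that by blast
qed

lemma len_wprod_le: "u \<in> lists S \<Longrightarrow> len (wprod u) \<le> length u"
  unfolding cox_length_def by (rule Least_le) blast

lemma len_inv_le: "w \<in> carrier G \<Longrightarrow> len (inv w) \<le> len w"
  by (metis reduced_word inv_wprod len_wprod_le length_rev rev_in_lists)

lemma len_inv [simp]: "w \<in> carrier G \<Longrightarrow> len (inv w) = len w"
  by (metis len_inv_le inv_closed inv_inv le_antisym)

section \<open>Reflection sequences and the deletion of letters\<close>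

text \<open>For \<open>u = s\<^sub>1 \<dots> s\<^sub>n\<close> this is the list of the reflections
  \<open>s\<^sub>1 \<dots> s\<^sub>i \<dots> s\<^sub>1\<close>; deleting \<open>s\<^sub>i\<close> from \<open>u\<close>
  multiplies the product of \<open>u\<close> by the \<open>i\<close>-th of them on the left.\<close>

fun reflections :: "'a list \<Rightarrow> 'a list" where
  "reflections [] = []"
| "reflections (s # u) = s # map (\<lambda>x. s \<otimes> x \<otimes> s) (reflections u)"

lemma length_reflections [simp]: "length (reflections u) = length u"
  by (induction u) auto

lemma reflections_closed: "u \<in> lists S \<Longrightarrow> set (reflections u) \<subseteq> carrier G"
  by (induction u) auto

lemma conj_generator_inj: "s \<in> S \<Longrightarrow> inj_on (\<lambda>x. s \<otimes> x \<otimes> s) (carrier G)"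
  by (rule inj_onI) simp

text \<open>The prefix acts on the later reflections only through its product, by conjugation. A
  prefix with trivial product therefore leaves them unchanged.\<close>

lemma reflections_append:
  assumes "u \<in> lists S" "v \<in> lists S"
  shows "reflections (u @ v) =
    reflections u @ map (\<lambda>x. wprod u \<otimes> x \<otimes> inv (wprod u)) (reflections v)"
  using assms
proof (induction u)
  case Nil
  thus ?case using reflections_closed[of v] by (auto intro!: map_idI[symmetric])
next
  case (Cons s u)
  thus ?case using reflections_closed[of v]
    by (auto simp: inv_mult_group m_assoc subset_iff)
qed

text \<open>If \<open>x\<close> is the first letter, drop it. Otherwise \<open>x\<close> is
  \<open>s y s\<close> for a reflection \<open>y\<close> of the tail, and a deletion there with
  \<open>u = y v\<close> gives \<open>s u = (s y s)(s v)\<close>.\<close>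

lemma delete_reflection:
  assumes "u \<in> lists S" "x \<in> set (reflections u)"
  shows "\<exists>v. subseq v u \<and> length v < length u \<and> wprod u = x \<otimes> wprod v"
  using assms
proof (induction u arbitrary: x)
  case (Cons s u)
  show ?case
  proof (cases "x = s")
    case True
    show ?thesis by (intro exI[of _ u]) (use True in auto)
  next
    case False
    then obtain y where y: "y \<in> set (reflections u)" "x = s \<otimes> y \<otimes> s" using Cons.prems by auto
    then obtain v where v: "subseq v u" "length v < length u" "wprod u = y \<otimes> wprod v"
      using Cons by auto
    have "v \<in> lists S" using v(1) Cons.hyps(2) by (rule subseq_in_lists)
    moreover have "y \<in> carrier G" using y reflections_closed Cons.hyps by auto
    ultimately show ?thesis
      by (intro exI[of _ "s # v"]) (use v y Cons.hyps in \<open>auto simp: m_assoc\<close>)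
  qed
qed simp

text \<open>A repetition within the tail is handled by induction. Otherwise the first letter
  \<open>s\<close> equals some \<open>s x s\<close>, so \<open>x = s\<close> is a reflection of the
  tail; deleting its letter leaves \<open>u = s v\<close>, and the two copies of \<open>s\<close>
  cancel.\<close>

lemma delete_repeated_reflection:
  assumes "u \<in> lists S" "\<not> distinct (reflections u)"
  shows "\<exists>v. subseq v u \<and> length v < length u \<and> wprod v = wprod u"
  using assms
proof (induction u)
  case (Cons s u)
  note s = Cons.hyps(1) and u = Cons.hyps(2)
  show ?case
  proof (cases "distinct (reflections u)")
    case False
    then obtain v where "subseq v u" "length v < length u" "wprod v = wprod u" using Cons.IH by auto
    thus ?thesis by (intro exI[of _ "s # v"]) auto
  next
    case True
    have "inj_on (\<lambda>x. s \<otimes> x \<otimes> s) (set (reflections u))"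
      using conj_generator_inj[OF s] reflections_closed[OF u] by (rule inj_on_subset)
    then obtain x where x: "x \<in> set (reflections u)" "s = s \<otimes> x \<otimes> s"
      using Cons.prems True by (auto simp: distinct_map)
    have xc: "x \<in> carrier G" using x reflections_closed[OF u] by auto
    have "s \<otimes> x \<otimes> s = s \<otimes> s \<otimes> s" using x(2) s by simp
    hence "x = s" using s xc by (simp del: generator_square)
    then obtain v where v: "subseq v u" "length v < length u" "wprod u = s \<otimes> wprod v"
      using delete_reflection[OF u x(1)] by auto
    have "v \<in> lists S" using v(1) u by (rule subseq_in_lists)
    thus ?thesis using v s by (intro exI[of _ v]) (auto intro: subseq_Cons')
  qed
qed simp

section \<open>Dihedral relators and the parity of reflections\<close>

fun alternating :: "'a \<Rightarrow> 'a \<Rightarrow> nat \<Rightarrow> 'a list" where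
  "alternating s t 0 = []"
| "alternating s t (Suc n) = s # alternating t s n"

lemma alternating_double: "alternating s t (2 * n) = concat (replicate n [s, t])"
  by (induction n) auto

text \<open>Alternating words of arbitrary length allow an induction by single letters, the roles of
  \<open>s\<close> and \<open>t\<close> being exchanged at each step; conjugation by
  \<open>s\<close> then raises the exponent by one.\<close>

lemma reflections_alternating:
  assumes "s \<in> S" "t \<in> S"
  shows "reflections (alternating s t n) = map (\<lambda>j. (s \<otimes> t) [^] j \<otimes> s) [0..<n]"
  using assms
proof (induction n arbitrary: s t)
  case (Suc n)
  have *: "s \<otimes> (t \<otimes> s) [^] j = (s \<otimes> t) [^] j \<otimes> s" for j :: nat
    by (induction j) (use Suc.prems in \<open>auto simp: m_assoc\<close>, simp flip: m_assoc)
  have "s \<otimes> ((t \<otimes> s) [^] j \<otimes> t) \<otimes> s = (s \<otimes> t) [^] Suc j \<otimes> s" for j :: nat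
    using Suc.prems *[of j] by (simp flip: m_assoc)
  thus ?case using Suc by (simp add: map_upt_Suc o_def del: upt_Suc nat_pow_Suc)
qed simp

lemma wprod_alternating_double:
  assumes "s \<in> S" "t \<in> S"
  shows "wprod (alternating s t (2 * n)) = (s \<otimes> t) [^] n"
proof (induction n)
  case (Suc n)
  have "(s \<otimes> t) [^] Suc n = (s \<otimes> t) \<otimes> (s \<otimes> t) [^] n"
    using assms by (intro nat_pow_Suc2) auto
  thus ?case using Suc assms by (simp add: m_assoc del: nat_pow_Suc)
qed simp

lemma alternating_in_lists: "s \<in> S \<Longrightarrow> t \<in> S \<Longrightarrow> alternating s t n \<in> lists S"
  by (induction n arbitrary: s t) auto

text \<open>Since \<open>(s t)\<close> has trivial \<open>m\<close>-th power, the powers repeat with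
  period \<open>m\<close>, and the second half of the \<open>2 * m\<close> reflections copies the
  first.\<close>

lemma reflections_relator:
  assumes "s \<in> S" "t \<in> S" "wprod (concat (replicate m [s, t])) = \<one>"
  shows "\<exists>l. reflections (concat (replicate m [s, t])) = l @ l"
proof -
  have one: "(s \<otimes> t) [^] m = \<one>"
    using wprod_alternating_double[of s t m] assms by (simp add: alternating_double)
  have "(s \<otimes> t) [^] (m + j) = (s \<otimes> t) [^] j" for j
    using assms one by (simp flip: nat_pow_mult)
  moreover have "[0..<2 * m] = [0..<m] @ map (\<lambda>j. m + j) [0..<m]"
    by (rule nth_equalityI) (auto simp: nth_append)
  ultimately have "reflections (alternating s t (2 * m)) =
      map (\<lambda>j. (s \<otimes> t) [^] j \<otimes> s) [0..<m] @ map (\<lambda>j. (s \<otimes> t) [^] j \<otimes> s) [0..<m]"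
    by (simp add: reflections_alternating[OF assms(1,2)] o_def)
  thus ?thesis by (auto simp: alternating_double)
qed

text \<open>The deleted relator contributes a conjugate of a list \<open>l @ l\<close>, which
  changes every count by an even number; its trivial product leaves the reflections coming from
  \<open>v\<close> as they were.\<close>

lemma odd_reflections_step:
  assumes "wprod xs = wprod ys" "coxeter_step S m xs ys"
  shows "odd (count_list (reflections xs) x) = odd (count_list (reflections ys) x)"
proof -
  obtain u v s t where w: "u \<in> lists S" "v \<in> lists S" "s \<in> S" "t \<in> S"
    and xs: "xs = u @ concat (replicate (m s t) [s, t]) @ v" and ys: "ys = u @ v"
    using assms(2) unfolding coxeter_step_def by blast
  define r where "r = concat (replicate (m s t) [s, t])"
  have r: "r \<in> lists S" unfolding r_def using alternating_in_lists[OF w(3,4)]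
    by (simp flip: alternating_double)
  have "wprod u \<otimes> (wprod r \<otimes> wprod v) = wprod u \<otimes> wprod v"
    using assms(1) w r by (simp add: xs ys flip: r_def)
  hence one: "wprod r = \<one>" using w r by simp
  then obtain l where l: "reflections r = l @ l"
    using reflections_relator[OF w(3,4)] unfolding r_def by blast
  have "map (\<lambda>x. \<one> \<otimes> x \<otimes> \<one>) (reflections v) = reflections v"
    using reflections_closed[OF w(2)] by (auto intro!: map_idI)
  thus ?thesis using w r one l
    by (simp add: xs ys reflections_append flip: r_def) argo
qed

lemma odd_reflections_wprod:
  assumes "u \<in> lists S" "v \<in> lists S" "wprod u = wprod v"
  shows "odd (count_list (reflections u) x) = odd (count_list (reflections v) x)"
proof -
  obtain m where m: "\<And>u v. u \<in> lists S \<Longrightarrow> v \<in> lists S \<Longrightarrow>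
      wprod u = wprod v \<longleftrightarrow> equivclp (coxeter_step S m) u v"
    using cox by (auto simp: coxeter_system_def)
  have step: "xs \<in> lists S \<and> ys \<in> lists S" if "coxeter_step S m xs ys" for xs ys
    using that alternating_in_lists unfolding coxeter_step_def
    by (auto simp flip: alternating_double simp del: in_lists_conv_set)
  have inv: "odd (count_list (reflections xs) x) = odd (count_list (reflections ys) x)"
    if "coxeter_step S m xs ys" for xs ys
    \<comment> \<open>By the presentation, a single step already preserves the product.\<close>
    using odd_reflections_step[OF _ that] m step[OF that] r_into_equivclp[of "coxeter_step S m", OF that] by blast
  have "equivclp (coxeter_step S m) u v" using assms m by blast
  thus ?thesis by (induction rule: equivclp_induct) (use inv in auto)
qed

text \<open>Were the reflections of \<open>u\<close> distinct, each would occur once, hence an odd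
  number of times in a reduced word \<open>v\<close> for the same element. Then \<open>v\<close>
  would need at least \<open>length u\<close> letters.\<close>

theorem deletion:
  assumes "u \<in> lists S" "len (wprod u) < length u"
  shows "\<exists>v. subseq v u \<and> length v < length u \<and> wprod v = wprod u"
proof (rule delete_repeated_reflection[OF assms(1)], rule notI)
  assume d: "distinct (reflections u)"
  obtain v where v: "v \<in> lists S" "length v = len (wprod u)" "wprod v = wprod u"
    using reduced_word assms(1) by (metis wprod_closed)
  have "set (reflections u) \<subseteq> set (reflections v)"
  proof
    fix x assume "x \<in> set (reflections u)"
    hence "odd (count_list (reflections u) x)" using d by (simp add: count_list_distinct)
    hence "odd (count_list (reflections v) x)"
      using odd_reflections_wprod[OF assms(1) v(1)] v(3) by simp
    thus "x \<in> set (reflections v)" by (metis count_notin even_zero)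
  qed
  hence "card (set (reflections u)) \<le> card (set (reflections v))" by (simp add: card_mono)
  also have "\<dots> \<le> length v" using card_length[of "reflections v"] by simp
  finally show False using assms(2) v(2) d by (simp add: distinct_card)
qed

corollary reduced_subword:
  assumes "u \<in> lists S"
  shows "\<exists>v. subseq v u \<and> length v = len (wprod u) \<and> wprod v = wprod u"
  using assms
proof (induction "length u" arbitrary: u rule: less_induct)
  case less
  show ?case
  proof (cases "len (wprod u) < length u")
    case True
    then obtain v where v: "subseq v u" "length v < length u" "wprod v = wprod u"
      using deletion less.prems by blast
    moreover have "v \<in> lists S" using v(1) less.prems by (rule subseq_in_lists)
    ultimately obtain w where "subseq w v" "length w = len (wprod v)" "wprod w = wprod v"
      using less.hyps by blast
    thus ?thesis using v by (metis subseq_order.order_trans)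
  next
    case False
    thus ?thesis using len_wprod_le[OF less.prems] by auto
  qed
qed

section \<open>Minimal double coset representatives\<close>

lemma reduced_word_last:
  assumes "v \<in> carrier G" "s \<in> S" "len (v \<otimes> s) < len v"
  obtains u where "u \<in> lists S" "wprod u = v \<otimes> s" "len v = Suc (length u)"
proof -
  obtain u where u: "u \<in> lists S" "length u = len (v \<otimes> s)" "wprod u = v \<otimes> s"
    using assms reduced_word[of "v \<otimes> s"] by auto
  have "wprod (u @ [s]) = v" using u assms by (simp add: m_assoc)
  hence "len v \<le> Suc (length u)" using len_wprod_le[of "u @ [s]"] u assms by auto
  thus ?thesis using that u assms(3) by auto
qed

text \<open>Let \<open>u @ [s]\<close> be a reduced word for \<open>v\<close>. A reduced word for
  \<open>t \<otimes> v\<close> can be chosen as a subword of \<open>t # u @ [s]\<close>; the cases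
  record which of the two end letters survive.\<close>

lemma two_sided_descent:
  assumes v: "v \<in> carrier G" and s: "s \<in> S" and t: "t \<in> S"
    and dr: "len (v \<otimes> s) < len v" and dl: "len (t \<otimes> v) < len v"
    and ne: "t \<otimes> v \<otimes> s \<noteq> v"
  shows "len (t \<otimes> v \<otimes> s) < len v"
proof (rule ccontr)
  assume nl: "\<not> len (t \<otimes> v \<otimes> s) < len v"
  obtain u where u: "u \<in> lists S" "wprod u = v \<otimes> s" "len v = Suc (length u)"
    using reduced_word_last[OF v s dr] .
  have "wprod (t # u @ [s]) = t \<otimes> v" using u v s t by (simp add: m_assoc)
  then obtain x where x: "subseq x (t # u @ [s])" "length x = len (t \<otimes> v)" "wprod x = t \<otimes> v"
    using reduced_subword[of "t # u @ [s]"] u s t by auto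
  obtain y z where yz: "x = y @ z" "subseq y (t # u)" "subseq z [s]"
    using x(1) subseq_append_iff[of x "t # u" "[s]"] by auto
  have y: "y \<in> lists S" using subseq_in_lists[OF yz(2)] u t by simp
  have "z = [] \<or> z = [s]" using yz(3) by (cases z) (auto split: if_splits)
  thus False
  proof
    \<comment> \<open>The last letter survives: removing it gives a word for
      \<open>t \<otimes> v \<otimes> s\<close> that is too short.\<close>
    assume z: "z = [s]"
    hence "t \<otimes> v \<otimes> s = wprod y" using x(3) yz(1) y s by (simp flip: x(3) add: m_assoc)
    thus False using len_wprod_le[OF y] nl dl x(2) yz(1) z by simp
  next
    assume z: "z = []"
    hence tv: "wprod y = t \<otimes> v" "length y = len (t \<otimes> v)" using x yz by auto
    have v': "v = t \<otimes> wprod y" using tv v t by simp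
    show False
    proof (cases "subseq y u")
      case True
      show False
      proof (cases "length y = length u")
        case True
        \<comment> \<open>Only here do the lengths agree, and then
          \<open>t \<otimes> v = v \<otimes> s\<close>, against \<open>ne\<close>. All other cases
          give a word for \<open>v\<close> shorter than \<open>len v\<close>.\<close>
        hence "y = u" using \<open>subseq y u\<close> by (simp add: subseq_same_length)
        hence "t \<otimes> v = v \<otimes> s" using tv u by simp
        hence "t \<otimes> v \<otimes> s = v" using v s by (simp add: m_assoc)
        thus False using ne by simp
      next
        case False
        hence "length y < length u" using True list_emb_length by fastforce
        moreover have "len v \<le> length (t # y)" using len_wprod_le[of "t # y"] v' y t by simp
        ultimately show False using u by simp
      qed
    next
      case False
      then obtain y' where y': "y = t # y'" "subseq y' u" using yz(2)
        by (cases y) (auto split: if_splits)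
      hence "v = wprod y'" using v' y t by simp
      moreover have "length y' \<le> length u" using y'(2) by (rule list_emb_length)
      ultimately show False using len_wprod_le[of y'] y y' u by simp
    qed
  qed
qed

section \<open>Double cosets of parabolic subgroups, described by words\<close>

definition double_coset :: "'a set \<Rightarrow> 'a set \<Rightarrow> 'a \<Rightarrow> 'a set" where
  "double_coset I J w = {wprod a \<otimes> w \<otimes> wprod b | a b. a \<in> lists I \<and> b \<in> lists J}"

lemma lists_S: "I \<subseteq> S \<Longrightarrow> a \<in> lists I \<Longrightarrow> a \<in> lists S"
  by (meson lists_mono subsetD)

lemma double_coset_closed:
  "I \<subseteq> S \<Longrightarrow> J \<subseteq> S \<Longrightarrow> w \<in> carrier G \<Longrightarrow> double_coset I J w \<subseteq> carrier G"
  using lists_S[of I] lists_S[of J] by (auto simp: double_coset_def)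

lemma double_coset_refl: "w \<in> carrier G \<Longrightarrow> w \<in> double_coset I J w"
  unfolding double_coset_def by (auto intro!: exI[of _ "[]"])

lemma double_coset_trans:
  assumes "I \<subseteq> S" "J \<subseteq> S" "w \<in> carrier G" "v \<in> double_coset I J w" "x \<in> double_coset I J v"
  shows "x \<in> double_coset I J w"
proof -
  obtain a b where ab: "a \<in> lists I" "b \<in> lists J" "v = wprod a \<otimes> w \<otimes> wprod b"
    using assms(4) by (auto simp: double_coset_def)
  obtain c d where cd: "c \<in> lists I" "d \<in> lists J" "x = wprod c \<otimes> v \<otimes> wprod d"
    using assms(5) by (auto simp: double_coset_def)
  have "x = wprod (c @ a) \<otimes> w \<otimes> wprod (b @ d)"
    using ab cd assms(3) lists_S[OF assms(1)] lists_S[OF assms(2)] by (simp add: m_assoc)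
  moreover have "c @ a \<in> lists I" "b @ d \<in> lists J" using ab cd by auto
  ultimately show ?thesis unfolding double_coset_def by blast
qed

text \<open>Reversing a word over \<open>I\<close> or \<open>J\<close> inverts its product and keeps
  its letters.\<close>

lemma double_coset_sym:
  assumes "I \<subseteq> S" "J \<subseteq> S" "w \<in> carrier G" "v \<in> double_coset I J w"
  shows "w \<in> double_coset I J v"
proof -
  obtain a b where ab: "a \<in> lists I" "b \<in> lists J" "v = wprod a \<otimes> w \<otimes> wprod b"
    using assms(4) by (auto simp: double_coset_def)
  have abS: "a \<in> lists S" "b \<in> lists S" using ab lists_S assms by auto
  have "w = inv (wprod a) \<otimes> v \<otimes> inv (wprod b)"
    using ab(3) abS assms(3) by (simp add: m_assoc inv_solve_left)
  hence "w = wprod (rev a) \<otimes> v \<otimes> wprod (rev b)" using abS by (simp add: inv_wprod)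
  moreover have "rev a \<in> lists I" "rev b \<in> lists J" using ab by auto
  ultimately show ?thesis unfolding double_coset_def by blast
qed

text \<open>Write \<open>x = a d b\<close> with words \<open>a\<close>, \<open>b\<close> of minimal total
  length. Deleting letters from the resulting word can neither shorten \<open>a\<close> or \<open>b\<close> nor,
  as \<open>d\<close> is shortest in its double coset, \<open>d\<close>; so the word is reduced, and a letter of
  \<open>a\<close> or \<open>b\<close> would give a descent of \<open>x\<close>.\<close>

lemma double_coset_min_unique:
  assumes I: "I \<subseteq> S" and J: "J \<subseteq> S" and d: "d \<in> carrier G"
    and min: "\<And>y. y \<in> double_coset I J d \<Longrightarrow> len d \<le> len y"
    and x: "x \<in> double_coset I J d"
    and nl: "\<And>s. s \<in> I \<Longrightarrow> \<not> len (s \<otimes> x) < len x"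
    and nr: "\<And>s. s \<in> J \<Longrightarrow> \<not> len (x \<otimes> s) < len x"
  shows "x = d"
proof -
  define P where "P = (\<lambda>(a, b). a \<in> lists I \<and> b \<in> lists J \<and> x = wprod a \<otimes> d \<otimes> wprod b)"
  have "\<exists>p. P p" using x unfolding double_coset_def P_def by auto
  then obtain p where "P p" and pmin: "\<And>q. P q \<Longrightarrow>
      length (fst p) + length (snd p) \<le> length (fst q) + length (snd q)"
    using ex_has_least_nat[of P _ "\<lambda>p. length (fst p) + length (snd p)"] by blast
  then obtain a b where ab: "p = (a, b)" "a \<in> lists I" "b \<in> lists J" "x = wprod a \<otimes> d \<otimes> wprod b"
    by (cases p) (auto simp: P_def)
  have abS: "a \<in> lists S" "b \<in> lists S" using ab lists_S I J by auto
  obtain w where w: "w \<in> lists S" "length w = len d" "wprod w = d" using reduced_word[OF d] .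
  have prod: "wprod (a @ w @ b) = x" using ab abS w d by (simp add: m_assoc)
  obtain v where v: "subseq v (a @ w @ b)" "length v = len x" "wprod v = x"
    using reduced_subword[of "a @ w @ b"] abS w prod by auto
  obtain a' v' where v1: "v = a' @ v'" "subseq a' a" "subseq v' (w @ b)"
    using v(1) by (auto simp: subseq_append_iff[of v])
  obtain w' b' where v2: "v' = w' @ b'" "subseq w' w" "subseq b' b"
    using v1(3) by (auto simp: subseq_append_iff[of v'])
  have a': "a' \<in> lists I" "a' \<in> lists S" and b': "b' \<in> lists J" "b' \<in> lists S"
    and w': "w' \<in> lists S"
    using subseq_in_lists v1 v2 ab abS w by blast+
  have x': "x = wprod a' \<otimes> wprod w' \<otimes> wprod b'"
    using v(3) a' b' w' v1 v2 by (simp add: m_assoc)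
  have "x \<in> double_coset I J (wprod w')" using a' b' x' unfolding double_coset_def by blast
  hence "wprod w' \<in> double_coset I J x" using double_coset_sym[OF I J] w' by simp
  hence "wprod w' \<in> double_coset I J d" using double_coset_trans[OF I J d x] by simp
  hence "length w \<le> length w'" using min len_wprod_le[OF w'] w(2) by fastforce
  hence "w' = w" using v2(2) list_emb_length[OF v2(2)] by (simp add: subseq_same_length)
  hence "P (a', b')" using a' b' x' w by (simp add: P_def)
  hence "length a + length b \<le> length a' + length b'" using pmin ab(1) by fastforce
  hence red: "len x = length a + length w + length b"
    using v(2) v1 v2 \<open>w' = w\<close> list_emb_length[OF v1(2)] list_emb_length[OF v2(3)] by simp
  have "a = []"
  proof (rule ccontr)
    assume "a \<noteq> []"
    then obtain s c where c: "a = s # c" by (cases a) auto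
    have "s \<otimes> x = wprod (c @ w @ b)" using c abS w ab d by (simp add: m_assoc)
    hence "len (s \<otimes> x) < len x" using len_wprod_le[of "c @ w @ b"] red c abS w by simp
    thus False using nl c ab by auto
  qed
  moreover have "b = []"
  proof (rule ccontr)
    assume "b \<noteq> []"
    then obtain s c where c: "b = c @ [s]" by (cases b rule: rev_cases) auto
    have "x \<otimes> s = wprod (a @ w @ c)" using c abS w ab d by (simp add: m_assoc)
    hence "len (x \<otimes> s) < len x" using len_wprod_le[of "a @ w @ c"] red c abS w by simp
    thus False using nr c ab by auto
  qed
  ultimately show ?thesis using ab d by simp
qed

text \<open>Both elements coincide with a shortest element \<open>d\<close> of their common double
  coset.\<close>

lemma double_coset_unique:
  assumes I: "I \<subseteq> S" and J: "J \<subseteq> S" and x: "x \<in> carrier G" and y: "y \<in> double_coset I J x"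
    and "\<And>s. s \<in> I \<Longrightarrow> \<not> len (s \<otimes> x) < len x" "\<And>s. s \<in> J \<Longrightarrow> \<not> len (x \<otimes> s) < len x"
    and "\<And>s. s \<in> I \<Longrightarrow> \<not> len (s \<otimes> y) < len y" "\<And>s. s \<in> J \<Longrightarrow> \<not> len (y \<otimes> s) < len y"
  shows "x = y"
proof -
  obtain d where d: "d \<in> double_coset I J x" "\<And>z. z \<in> double_coset I J x \<Longrightarrow> len d \<le> len z"
    using ex_has_least_nat[of "\<lambda>z. z \<in> double_coset I J x" _ len] y by blast
  have dc: "d \<in> carrier G" using d(1) double_coset_closed[OF I J x] by auto
  have xd: "x \<in> double_coset I J d" by (rule double_coset_sym[OF I J x d(1)])
  have min: "len d \<le> len z" if "z \<in> double_coset I J d" for z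
    using d(2) double_coset_trans[OF I J x d(1) that] .
  have "x = d" using assms by (intro double_coset_min_unique[OF I J dc min xd])
  moreover have "y = d"
    using assms by (intro double_coset_min_unique[OF I J dc min double_coset_trans[OF I J dc xd y]])
  ultimately show ?thesis by simp
qed

end

section \<open>Minimal elements of the components\<close>

text \<open>Expand the product of \<open>card A\<close> factors \<open>y + 1\<close>, choosing
  \<open>y\<close> at the members of \<open>B\<close>.\<close>

lemma sum_power_card_Pow:
  fixes y :: "'c :: comm_semiring_1"
  assumes "finite A"
  shows "(\<Sum>B\<in>Pow A. y ^ card B) = (1 + y) ^ card A"
  using prod_add[OF assms, of "\<lambda>_. y" "\<lambda>_. 1"] by (simp add: add.commute)

text \<open>Supplies the uniqueness behind the description in \<open>h_poly\<close>, which says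
  nothing at the pole.\<close>

lemma poly_eq_except_point:
  fixes p q :: "real poly"
  assumes "\<And>x. x \<noteq> a \<Longrightarrow> poly p x = poly q x"
  shows "p = q"
proof (rule ccontr)
  assume "p \<noteq> q"
  hence "finite {x. poly (p - q) x = 0}" by (intro poly_roots_finite) simp
  moreover have "- {a} \<subseteq> {x. poly (p - q) x = 0}" using assms by auto
  ultimately have "finite (- {a})" by (rule finite_subset[rotated])
  thus False by (simp add: infinite_UNIV_char_0)
qed

section \<open>Twisted involutions and the action of the generators\<close>

locale twisted_coxeter_group = coxeter_group +
  fixes \<theta> :: "'a \<Rightarrow> 'a"
  assumes fin: "finite (carrier G)" and iso: "\<theta> \<in> iso G G"
    and involution: "w \<in> carrier G \<Longrightarrow> \<theta> (\<theta> w) = w" and image_S: "\<theta> ` S = S"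
begin

abbreviation twisted :: "'a set" where "twisted \<equiv> twisted_involutions G \<theta>"
abbreviation act :: "'a \<Rightarrow> 'a \<Rightarrow> 'a" where "act \<equiv> underline_act G \<theta>"
abbreviation component :: "'a \<Rightarrow> 'a set \<Rightarrow> ('a, 'a) lgraph" where
  "component \<equiv> coset_component G S \<theta>"

lemma finite_S: "finite S"
  using fin by (rule finite_subset[rotated]) auto

lemma finite_twisted: "finite twisted"
  using fin by (rule finite_subset[rotated]) (auto simp: twisted_involutions_def)

lemma theta_S [simp]: "s \<in> S \<Longrightarrow> \<theta> s \<in> S"
  using image_S by auto

lemma theta_mult: "x \<in> carrier G \<Longrightarrow> y \<in> carrier G \<Longrightarrow> \<theta> (x \<otimes> y) = \<theta> x \<otimes> \<theta> y"
  using iso by (auto simp: iso_def hom_def)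

lemma theta_one: "\<theta> \<one> = \<one>"
  using iso by (meson hom_one is_group iso_imp_homomorphism)

lemma theta_closed: "x \<in> carrier G \<Longrightarrow> \<theta> x \<in> carrier G"
  using iso by (auto simp: iso_def hom_def)

lemma theta_wprod: "u \<in> lists S \<Longrightarrow> \<theta> (wprod u) = wprod (map \<theta> u)"
  by (induction u) (auto simp: theta_one theta_mult)

lemma len_theta_le:
  assumes "w \<in> carrier G"
  shows "len (\<theta> w) \<le> len w"
proof -
  obtain u where u: "u \<in> lists S" "length u = len w" "wprod u = w" using reduced_word[OF assms] .
  have "map \<theta> u \<in> lists S" using u(1) by (simp add: in_lists_conv_set)
  thus ?thesis using len_wprod_le[of "map \<theta> u"] theta_wprod[OF u(1)] u by simp
qed

lemma len_theta: "w \<in> carrier G \<Longrightarrow> len (\<theta> w) = len w"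
  using len_theta_le[of w] len_theta_le[of "\<theta> w"] theta_closed involution by simp

lemma twisted_closed: "w \<in> twisted \<Longrightarrow> w \<in> carrier G"
  by (simp add: twisted_involutions_def)

text \<open>Inversion followed by \<open>\<theta>\<close> preserves length and sends
  \<open>\<theta> s \<otimes> w\<close> to \<open>w \<otimes> s\<close>, because
  \<open>\<theta>\<close> inverts \<open>w\<close>.\<close>

lemma len_left_twisted:
  assumes w: "w \<in> twisted" and s: "s \<in> S"
  shows "len (\<theta> s \<otimes> w) = len (w \<otimes> s)"
proof -
  have wc: "w \<in> carrier G" using w by (rule twisted_closed)
  have "\<theta> (inv (\<theta> s \<otimes> w)) = \<theta> (inv w \<otimes> \<theta> s)" using s wc by (simp add: inv_mult_group)
  also have "\<dots> = \<theta> (\<theta> w) \<otimes> \<theta> (\<theta> s)"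
    using w wc s by (simp add: theta_mult twisted_involutions_def)
  also have "\<dots> = w \<otimes> s" using wc s by (simp add: involution)
  finally show ?thesis using wc s by (metis len_theta len_inv theta_S generator_closed m_closed inv_closed)
qed

lemma act_closed: "w \<in> twisted \<Longrightarrow> s \<in> S \<Longrightarrow> act w s \<in> twisted"
  using underline_act_closed[OF cox iso involution image_S] .

text \<open>In the conjugation case \<open>s\<close> is a right and \<open>\<theta> s\<close> a left
  descent, so \<open>two_sided_descent\<close> applies; in the other case the claim is the
  assumption \<open>d\<close>.\<close>

lemma len_act_less:
  assumes w: "w \<in> twisted" and s: "s \<in> S" and d: "len (w \<otimes> s) < len w"
  shows "len (act w s) < len w"
  unfolding underline_act_def
  using two_sided_descent[OF twisted_closed[OF w] s theta_S[OF s] d] len_left_twisted[OF w s] d by simp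

section \<open>Components and their descent-free elements\<close>

definition minimal_elements :: "'a set \<Rightarrow> 'a set" where
  "minimal_elements J = {w \<in> twisted. right_descents G S w \<inter> J = {}}"

lemma component_verts:
  "fst (component w J) = lcomponent_verts (keep_labels J (twisted_graph G S \<theta>)) w"
  by (simp add: coset_component_def lcomponent_def)

lemma component_eq: "v \<in> fst (component w J) \<Longrightarrow> component v J = component w J"
  using mem_lcomponent_verts_sym unfolding component_verts by (simp add: coset_component_def)

lemma self_in_component: "w \<in> fst (component w J)"
  by (simp add: component_verts lcomponent_verts_def)

text \<open>An edge is an unordered pair and does not record which end is acted on, whence the
  disjunction.\<close>

lemma edge_keep_labels:
  "({x, y}, s) \<in> snd (keep_labels J (twisted_graph G S \<theta>)) \<longleftrightarrow>
   x \<in> twisted \<and> y \<in> twisted \<and> s \<in> S \<inter> J \<and> (act x s = y \<or> act y s = x)"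
  by (auto simp: keep_labels_def twisted_graph_def doubleton_eq_iff)

lemma act_in_component:
  assumes "w \<in> twisted" "s \<in> J" "J \<subseteq> S"
  shows "act w s \<in> fst (component w J)"
  unfolding component_verts lcomponent_verts_def
  using assms act_closed[of w s] by (auto simp: edge_keep_labels intro!: r_into_rtrancl)

text \<open>Acting by a right descent in \<open>J\<close> stays in the component and lowers the
  length, so the process ends.\<close>

lemma component_minimal_exists:
  assumes "w \<in> twisted" "J \<subseteq> S"
  shows "\<exists>v\<in>minimal_elements J. component v J = component w J"
  using assms(1)
proof (induction "len w" arbitrary: w rule: less_induct)
  case less
  show ?case
  proof (cases "w \<in> minimal_elements J")
    case False
    then obtain s where s: "s \<in> J" "s \<in> S" "len (w \<otimes> s) < len w"
      using less.prems by (auto simp: minimal_elements_def right_descents_def)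
    have "\<exists>v\<in>minimal_elements J. component v J = component (act w s) J"
      using less.hyps len_act_less act_closed less.prems s by blast
    thus ?thesis using component_eq[OF act_in_component[OF less.prems s(1) assms(2)]] by simp
  qed auto
qed

lemma act_edge_cases:
  assumes "x \<in> carrier G" "s \<in> S" "act x s = y \<or> (y \<in> carrier G \<and> act y s = x)"
  shows "y = x \<otimes> s \<or> y = \<theta> s \<otimes> x \<otimes> s"
  using assms by (auto simp: underline_act_def m_assoc split: if_splits)

text \<open>Along an edge labelled \<open>s\<close>, in either direction, the vertex is multiplied
  by \<open>s\<close> on the right and by nothing or \<open>\<theta> s\<close> on the left.\<close>

lemma component_subset_double_coset:
  assumes w: "w \<in> twisted" and J: "J \<subseteq> S" and v: "v \<in> fst (component w J)"
  shows "v \<in> twisted \<and> v \<in> double_coset (\<theta> ` J) J w"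
proof -
  have I: "\<theta> ` J \<subseteq> S" using J by auto
  have "(w, v) \<in> {(x, y). \<exists>s. ({x, y}, s) \<in> snd (keep_labels J (twisted_graph G S \<theta>))}\<^sup>*"
    using v by (simp add: component_verts lcomponent_verts_def)
  thus ?thesis
  proof (induction rule: rtrancl_induct)
    case base
    show ?case using w double_coset_refl twisted_closed by auto
  next
    case (step x y)
    then obtain s where s: "s \<in> S" "s \<in> J" and y: "y \<in> twisted" "act x s = y \<or> act y s = x"
      by (auto simp: edge_keep_labels)
    have x: "x \<in> carrier G" using step twisted_closed by auto
    have "y = x \<otimes> s \<or> y = \<theta> s \<otimes> x \<otimes> s" using act_edge_cases x s y twisted_closed by blast
    hence "y = wprod [] \<otimes> x \<otimes> wprod [s] \<or> y = wprod [\<theta> s] \<otimes> x \<otimes> wprod [s]"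
      using x s by auto
    moreover have "[] \<in> lists (\<theta> ` J)" "[\<theta> s] \<in> lists (\<theta> ` J)" "[s] \<in> lists J" using s by auto
    ultimately have "y \<in> double_coset (\<theta> ` J) J x" unfolding double_coset_def by blast
    thus ?case using double_coset_trans[OF I J twisted_closed[OF w]] step y by blast
  qed
qed

lemma minimal_no_descents:
  assumes "w \<in> minimal_elements J" "J \<subseteq> S"
  shows "s \<in> J \<Longrightarrow> \<not> len (w \<otimes> s) < len w" "t \<in> \<theta> ` J \<Longrightarrow> \<not> len (t \<otimes> w) < len w"
proof -
  have w: "w \<in> twisted" "\<And>s. s \<in> J \<Longrightarrow> \<not> len (w \<otimes> s) < len w"
    using assms by (auto simp: minimal_elements_def right_descents_def)
  show "s \<in> J \<Longrightarrow> \<not> len (w \<otimes> s) < len w" by (rule w(2))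
  show "t \<in> \<theta> ` J \<Longrightarrow> \<not> len (t \<otimes> w) < len w"
    using w(2) len_left_twisted[OF w(1)] assms(2) by auto
qed

lemma component_minimal_unique:
  assumes v: "v \<in> minimal_elements J" and w: "w \<in> minimal_elements J" and J: "J \<subseteq> S"
    and eq: "component v J = component w J"
  shows "v = w"
proof -
  have I: "\<theta> ` J \<subseteq> S" using J by auto
  have wt: "w \<in> twisted" using w by (simp add: minimal_elements_def)
  have "v \<in> fst (component w J)" using self_in_component[of v J] eq by simp
  hence "v \<in> double_coset (\<theta> ` J) J w" using component_subset_double_coset[OF wt J] by blast
  thus ?thesis
    using double_coset_unique[OF I J twisted_closed[OF wt]]
      minimal_no_descents[OF v J] minimal_no_descents[OF w J] by blast
qed

lemma component_labels: "w \<in> twisted \<Longrightarrow> J \<subseteq> S \<Longrightarrow> snd ` snd (component w J) = J"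
  using coset_component_labels[OF cox iso involution image_S] .

text \<open>A cell determines \<open>J\<close> as its set of edge labels, and then \<open>w\<close>
  as the only element of \<open>minimal_elements J\<close> in it.\<close>

lemma bij_betw_cells:
  "bij_betw (\<lambda>(J, w). component w J) (SIGMA J : Pow S. minimal_elements J) (twisted_cells G S \<theta>)"
proof (rule bij_betw_imageI)
  show "inj_on (\<lambda>(J, w). component w J) (SIGMA J : Pow S. minimal_elements J)"
  proof (rule inj_onI, clarify)
    fix J v K w
    assume *: "J \<subseteq> S" "v \<in> minimal_elements J" "K \<subseteq> S" "w \<in> minimal_elements K"
      "component v J = component w K"
    have "J = K" using component_labels[of v J] component_labels[of w K] *
      by (simp add: minimal_elements_def)
    thus "J = K \<and> v = w" using component_minimal_unique * by simp
  qed
  have "component w J \<in> (\<lambda>(J, w). component w J) ` (SIGMA J : Pow S. minimal_elements J)"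
    if J: "J \<subseteq> S" and w: "w \<in> twisted" for w J
  proof -
    obtain v where "v \<in> minimal_elements J" "component v J = component w J"
      using component_minimal_exists[OF w J] by blast
    thus ?thesis using J by (intro image_eqI[of _ _ "(J, v)"]) auto
  qed
  thus "(\<lambda>(J, w). component w J) ` (SIGMA J : Pow S. minimal_elements J) = twisted_cells G S \<theta>"
    unfolding twisted_cells_def by (auto simp: minimal_elements_def)
qed

section \<open>The face and h-polynomials\<close>

lemma card_right_descents_le: "card (right_descents G S w) \<le> card S"
  by (rule card_mono[OF finite_S]) (auto simp: right_descents_def)

lemma complex_dim_eq: "nat (complex_dim (twisted_cells G S \<theta>) face_of + 1) = card S"
  using complex_dim_twisted_cells[OF cox iso involution image_S finite_S] by simp

lemma face_number_eq:
  assumes "i \<le> card S"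
  shows "face_number (twisted_cells G S \<theta>) face_of (int i - 1) =
    (\<Sum>J | J \<subseteq> S \<and> card (S - J) = i. card (minimal_elements J))"
proof -
  let ?c = "\<lambda>(J, w). component w J" and ?X = "SIGMA J : {J. J \<subseteq> S \<and> card (S - J) = i}. minimal_elements J"
  \<comment> \<open>Dimension \<open>i - 1\<close> means that exactly \<open>i\<close> labels are
    missing.\<close>
  have dim: "cell_dim (twisted_cells G S \<theta>) face_of (component w J) = int i - 1 \<longleftrightarrow> card (S - J) = i"
    if "J \<subseteq> S" "w \<in> minimal_elements J" for J w
  proof -
    have "card J \<le> card S" "card (S - J) = card S - card J"
      using that(1) finite_S by (auto simp: card_mono card_Diff_subset finite_subset)
    moreover have "w \<in> twisted" using that(2) by (simp add: minimal_elements_def)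
    ultimately show ?thesis
      using cell_dim_coset_component(2)[OF cox iso involution image_S finite_S _ that(1), of w] by auto
  qed
  have "{x \<in> twisted_cells G S \<theta>. cell_dim (twisted_cells G S \<theta>) face_of x = int i - 1} = ?c ` ?X"
    using dim unfolding bij_betw_imp_surj_on[OF bij_betw_cells, symmetric] by fastforce
  moreover have "inj_on ?c ?X"
    by (rule inj_on_subset[OF bij_betw_imp_inj_on[OF bij_betw_cells]]) auto
  ultimately have "face_number (twisted_cells G S \<theta>) face_of (int i - 1) = card ?X"
    by (simp add: face_number_def card_image)
  thus ?thesis using finite_S finite_twisted by (simp add: minimal_elements_def)
qed

text \<open>Grouping the cells by the minimal element \<open>w\<close> of the component, the labels missing
  from the component range over the sets between \<open>D\<^sub>R(w)\<close> and \<open>S\<close>.\<close>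

lemma poly_f_poly:
  "poly (f_poly (twisted_cells G S \<theta>) face_of) y =
   (\<Sum>w\<in>twisted. y ^ card (right_descents G S w) * (1 + y) ^ (card S - card (right_descents G S w)))"
proof -
  have finP: "finite (Pow S)" using finite_S by simp
  have "poly (f_poly (twisted_cells G S \<theta>) face_of) y =
      (\<Sum>i\<le>card S. (\<Sum>J | J \<subseteq> S \<and> card (S - J) = i. card (minimal_elements J)) * y ^ i)"
    by (simp add: f_poly_def complex_dim_eq poly_sum poly_monom face_number_eq atLeast0AtMost)
  also have "\<dots> = (\<Sum>i\<le>card S. \<Sum>J | J \<in> Pow S \<and> card (S - J) = i.
      card (minimal_elements J) * y ^ card (S - J))"
    by (auto simp: sum_distrib_right intro!: sum.cong)
  also have "\<dots> = (\<Sum>J\<in>Pow S. card (minimal_elements J) * y ^ card (S - J))"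
    using finite_S by (intro sum.group) (auto intro!: card_mono)
  also have "\<dots> = (\<Sum>J\<in>Pow S. \<Sum>w\<in>minimal_elements J. y ^ card (S - J))" by simp
  also have "\<dots> = (\<Sum>J\<in>Pow S. \<Sum>w | w \<in> twisted \<and> right_descents G S w \<inter> J = {}. y ^ card (S - J))"
    by (simp add: minimal_elements_def)
  also have "\<dots> = (\<Sum>w\<in>twisted. \<Sum>J | J \<in> Pow S \<and> right_descents G S w \<inter> J = {}. y ^ card (S - J))"
    by (rule sum.swap_restrict[OF finP finite_twisted])
  also have "\<dots> = (\<Sum>w\<in>twisted. \<Sum>B\<in>Pow (S - right_descents G S w).
      y ^ card (right_descents G S w) * y ^ card B)"
  proof (rule sum.cong[OF refl])
    fix w
    define D where "D = right_descents G S w"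
    have D: "D \<subseteq> S" by (auto simp: D_def right_descents_def)
    have c: "card (D \<union> B) = card D + card B" if "B \<subseteq> S - D" for B
      using that D finite_S by (intro card_Un_disjoint) (auto intro: finite_subset)
    show "(\<Sum>J | J \<in> Pow S \<and> D \<inter> J = {}. y ^ card (S - J)) = (\<Sum>B\<in>Pow (S - D). y ^ card D * y ^ card B)"
    \<comment> \<open>The missing labels \<open>S - J\<close> contain \<open>D\<close>;
      \<open>B\<close> is what remains of them outside \<open>D\<close>. The same formula recovers
      \<open>J\<close> from \<open>B\<close>.\<close>
    proof (rule sum.reindex_bij_witness[of _ "\<lambda>B. S - (D \<union> B)" "\<lambda>J. S - (D \<union> J)"])
      fix J assume J: "J \<in> {J. J \<in> Pow S \<and> D \<inter> J = {}}"
      have "S - J = D \<union> (S - (D \<union> J))" using J D by auto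
      moreover have "card (D \<union> (S - (D \<union> J))) = card D + card (S - (D \<union> J))" by (rule c) auto
      ultimately have "card (S - J) = card D + card (S - (D \<union> J))" by simp
      thus "y ^ card D * y ^ card (S - (D \<union> J)) = y ^ card (S - J)" by (simp add: power_add)
    qed auto
  qed
  also have "\<dots> = (\<Sum>w\<in>twisted. y ^ card (right_descents G S w) *
      (1 + y) ^ (card S - card (right_descents G S w)))"
  proof (rule sum.cong[OF refl])
    fix w
    have "right_descents G S w \<subseteq> S" by (auto simp: right_descents_def)
    hence "card (S - right_descents G S w) = card S - card (right_descents G S w)"
      using finite_S by (simp add: card_Diff_subset finite_subset)
    thus "(\<Sum>B\<in>Pow (S - right_descents G S w). y ^ card (right_descents G S w) * y ^ card B) =
        y ^ card (right_descents G S w) * (1 + y) ^ (card S - card (right_descents G S w))"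
      using finite_S by (simp add: sum_power_card_Pow flip: sum_distrib_left)
  qed
  finally show ?thesis .
qed

text \<open>With \<open>y = x / (1 - x)\<close> one has \<open>1 + y = 1 / (1 - x)\<close>, so a
  summand with \<open>k\<close> descents is \<open>x ^ k / (1 - x) ^ card S\<close>.\<close>

lemma poly_des_poly:
  assumes "x \<noteq> 1"
  shows "poly (des_poly G S \<theta>) x =
    (1 - x) ^ card S * poly (f_poly (twisted_cells G S \<theta>) face_of) (x / (1 - x))"
proof -
  have "x ^ k = (1 - x) ^ n * ((x / (1 - x)) ^ k * (1 + x / (1 - x)) ^ (n - k))" if "k \<le> n" for k n
  proof -
    have "1 + x / (1 - x) = 1 / (1 - x)" using assms by (simp add: field_simps)
    hence "(x / (1 - x)) ^ k * (1 + x / (1 - x)) ^ (n - k) = x ^ k / ((1 - x) ^ k * (1 - x) ^ (n - k))"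
      by (simp add: power_divide)
    \<comment> \<open>The bound \<open>k \<le> n\<close> keeps the natural subtraction
      \<open>n - k\<close> from truncating.\<close>
    also have "(1 - x) ^ k * (1 - x) ^ (n - k) = (1 - x) ^ n"
      using that by (simp flip: power_add)
    finally show ?thesis using assms by simp
  qed
  thus ?thesis
    unfolding des_poly_def poly_f_poly poly_sum poly_monom sum_distrib_left
    using card_right_descents_le by (intro sum.cong) auto
qed

lemma h_poly_eq_des_poly: "h_poly (twisted_cells G S \<theta>) face_of = des_poly G S \<theta>"
  unfolding h_poly_def complex_dim_eq
proof (rule the_equality)
  show "\<forall>x. x \<noteq> 1 \<longrightarrow> poly (des_poly G S \<theta>) x =
      (1 - x) ^ card S * poly (f_poly (twisted_cells G S \<theta>) face_of) (x / (1 - x))"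
    using poly_des_poly by blast
next
  fix h
  assume "\<forall>x. x \<noteq> 1 \<longrightarrow> poly h x =
      (1 - x) ^ card S * poly (f_poly (twisted_cells G S \<theta>) face_of) (x / (1 - x))"
  thus "h = des_poly G S \<theta>" using poly_des_poly by (intro poly_eq_except_point[of 1]) simp
qed

end

theorem theorem5p10:
  fixes W :: "('a, 'b) monoid_scheme" and S :: "'a set" and \<theta> :: "'a \<Rightarrow> 'a"
  assumes "coxeter_system W S"
    and "finite (carrier W)"
    and "\<theta> \<in> iso W W"
    and "\<And>w. w \<in> carrier W \<Longrightarrow> \<theta> (\<theta> w) = w"
    and "\<theta> ` S = S"
  shows "h_poly (twisted_cells W S \<theta>) face_of = des_poly W S \<theta>"
proof -
  interpret twisted_coxeter_group W S \<theta>
    using assms by unfold_locales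
  show ?thesis by (rule h_poly_eq_des_poly)
qed

end
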